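(* Let $w=(w_0,w_1,w_2)$ be a triple of pairwise coprime positive integers, $|w|=w_0+w_1+w_2$, $\bar w=w_0w_1w_2$, and let $L_w(d)=\#\{(x,y,z)\in\mathbb{Z}_{\ge 0}^3 : w_0x+w_1y+w_2z=d\}$ be the Ehrhart quasi-polynomial of the rational polygon $D_w=\{(x,y,z)\in\mathbb{R}^3 : x,y,z\ge 0,\ w_0x+w_1y+w_2z=1\}$. Then for every integer $d\ge 0$, $$L_w(d)=g_{w,d+|w|}-\sum_{P\in\operatorname{Sing}(\mathbb{P}^2_w)}\Delta_P(d+|w|).$$
   Context: The virtual genus is the quadratic polynomial in $k$ given by $g_{w,k}=\dfrac{k(k-|w|)}{2\bar w}+1$. $\mathbb{P}^2_w$ is the weighted projective plane, the quotient of $\mathbb{C}^3\setminus\{0\}$ by the $\mathbb{C}^*$-action $t\cdot(x_0,x_1,x_2)=(t^{w_0}x_0,t^{w_1}x_1,t^{w_2}x_2)$. Let $P_i$ ($i=0,1,2$) be the point at which the two coordinates other than $x_i$ vanish. Then $\operatorname{Sing}(\mathbb{P}^2_w)=\{P_i : w_i>1\}$, and with indices modulo 3 the local type at $P_i$ is $X(w_i;w_{i+1},w_{i+2})$. Here $X(d;a,b)$ denotes the quotient of $\mathbb{C}^2$ by the group of $d$-th roots of unity acting by $\xi\cdot(x,y)=(\xi^a x,\xi^b y)$. The invariant $\Delta_P(k)$. For positive integers $p,q$ with $\gcd(p,q)=1$ and an integer $r\ge 0$ set $$A^{(p,q)}_r=\#\{(i,j)\in\mathbb{Z}^2 : pi+qj\le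 qr,\ i,j\ge 1\},\qquad \delta^{(p,q)}_r=\frac{r(qr-p-q+1)}{2p}.$$ For $P$ the origin of $X(p;-1,q)$ and $k\ge 0$, define $\Delta_P(k)=A^{(p,q)}_r-\delta^{(p,q)}_r$, where $r\ge 0$ is an integer with $r\equiv q^{-1}k \pmod p$ (the value depends only on $r$ modulo $p$). At $P_i\in\mathbb{P}^2_w$ one uses the identification $X(w_i;w_{i+1},w_{i+2})=X(w_i;-1,q_i)$ with $q_i>0$, $q_i\equiv -w_{i+1}^{-1}w_{i+2}\pmod{w_i}$. Under it the index $k$ (degree with respect to the weights $w$) becomes $-w_{i+1}^{-1}k$. Thus $\Delta_{P_i}(k)=A^{(w_i,q_i)}_{r_i}-\delta^{(w_i,q_i)}_{r_i}$ with $r_i\ge 0$, $r_i\equiv w_{i+2}^{-1}k\pmod{w_i}$. *)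

theory Defs
  imports "HOL-Analysis.Analysis" "HOL-Number_Theory.Modular_Inverse"
begin

text \<open>
  A weight triple is a function on the three-element type \<^typ>\<open>3\<close>, whose
  arithmetic is arithmetic modulo 3 (so its elements are 0, 1, 2, and 3 = 0).
\<close>

definition pos_pairwise_coprime :: "(3 \<Rightarrow> int) \<Rightarrow> bool" where
  "pos_pairwise_coprime w \<longleftrightarrow>
     (\<forall>i. 0 < w i) \<and> (\<forall>i j. i \<noteq> j \<longrightarrow> coprime (w i) (w j))"

definition wsum :: "(3 \<Rightarrow> int) \<Rightarrow> int" where
  "wsum w = w 0 + w 1 + w 2"

definition wprod :: "(3 \<Rightarrow> int) \<Rightarrow> int" where
  "wprod w = w 0 * w 1 * w 2"

definition virtual_genus :: "(3 \<Rightarrow> int) \<Rightarrow> int \<Rightarrow> real" where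
  "virtual_genus w k =
     of_int k * (of_int k - of_int (wsum w)) / (2 * of_int (wprod w)) + 1"


subsection \<open>The Ehrhart quasi-polynomial\<close>

definition rational_polygon :: "(3 \<Rightarrow> int) \<Rightarrow> (real \<times> real \<times> real) set" where
  "rational_polygon w =
     {(x, y, z). 0 \<le> x \<and> 0 \<le> y \<and> 0 \<le> z \<and>
        of_int (w 0) * x + of_int (w 1) * y + of_int (w 2) * z = 1}"

definition ehrhart :: "(3 \<Rightarrow> int) \<Rightarrow> int \<Rightarrow> nat" where
  "ehrhart w d =
     card {(x :: int, y :: int, z :: int).
             0 \<le> x \<and> 0 \<le> y \<and> 0 \<le> z \<and> w 0 * x + w 1 * y + w 2 * z = d}"

lemma ehrhart_eq_card_dilate:
  assumes w: "\<And>i. 0 < w i" and d: "0 \<le> d"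
  shows "ehrhart w d =
    card {(x :: int, y :: int, z :: int).
      (of_int x, of_int y, of_int z) \<in> (\<lambda>v. of_int d *\<^sub>R v) ` rational_polygon w}"
proof -
  have "(0 \<le> x \<and> 0 \<le> y \<and> 0 \<le> z \<and> w 0 * x + w 1 * y + w 2 * z = d) \<longleftrightarrow>
    (of_int x, of_int y, of_int z) \<in> (\<lambda>v. of_int d *\<^sub>R v) ` rational_polygon w"
    (is "?L \<longleftrightarrow> ?R") for x y z
  proof
    assume L: ?L
    show ?R
    proof (cases "d = 0")
      case True
      have "w 0 * x \<ge> 0" "w 1 * y \<ge> 0" "w 2 * z \<ge> 0"
        using L w by (simp_all add: less_imp_le)
      with L True have "w 0 * x = 0" "w 1 * y = 0" "w 2 * z = 0" by linarith+
      with w[of 0] w[of 1] w[of 2] have z: "x = 0" "y = 0" "z = 0" by auto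
      have "(1 / of_int (w 0), 0, 0) \<in> rational_polygon w"
        using w[of 0] by (auto simp: rational_polygon_def)
      then show ?R
        by (rule rev_image_eqI) (simp add: z True)
    next
      case False
      let ?v = "(of_int x / of_int d, of_int y / of_int d, of_int z / of_int d)
                  :: real \<times> real \<times> real"
      have "real_of_int (w 0) * of_int x + of_int (w 1) * of_int y + of_int (w 2) * of_int z
              = of_int d"
        using L by (metis of_int_add of_int_mult)
      then have "?v \<in> rational_polygon w"
        using L d False by (simp add: rational_polygon_def add_divide_distrib [symmetric])
      moreover have "(of_int x, of_int y, of_int z) = of_int d *\<^sub>R ?v"
        using False by simp
      ultimately show ?R by (rule rev_image_eqI)
    qed
  next
    assume ?R
    then obtain a b c where abc: "(a, b, c) \<in> rational_polygon w"
      and eq: "real_of_int x = of_int d * a" "real_of_int y = of_int d * b"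
        "real_of_int z = of_int d * c"
      by auto
    have "0 \<le> real_of_int x" "0 \<le> real_of_int y" "0 \<le> real_of_int z"
      using abc d unfolding eq by (auto simp: rational_polygon_def)
    moreover have "real_of_int (w 0 * x + w 1 * y + w 2 * z) =
        of_int d * (of_int (w 0) * a + of_int (w 1) * b + of_int (w 2) * c)"
      by (simp add: eq algebra_simps)
    then have "real_of_int (w 0 * x + w 1 * y + w 2 * z) = real_of_int d"
      using abc by (simp add: rational_polygon_def)
    then have "w 0 * x + w 1 * y + w 2 * z = d"
      by (simp only: of_int_eq_iff)
    ultimately show ?L by simp
  qed
  then show ?thesis
    unfolding ehrhart_def by simp
qed


subsection \<open>The weighted projective plane\<close>

definition weighted_orbit :: "(3 \<Rightarrow> int) \<Rightarrow> complex ^ 3 \<Rightarrow> (complex ^ 3) set" where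
  "weighted_orbit w x = {\<chi> i. t powi (w i) * x $ i | t. t \<noteq> 0}"

definition weighted_plane :: "(3 \<Rightarrow> int) \<Rightarrow> (complex ^ 3) set set" where
  "weighted_plane w = weighted_orbit w ` (UNIV - {0})"

definition vertex :: "(3 \<Rightarrow> int) \<Rightarrow> 3 \<Rightarrow> (complex ^ 3) set" where
  "vertex w i = weighted_orbit w (axis i 1)"

text \<open>
  For pairwise coprime weights the local type of the plane at the i-th vertex is
  X(w i; w (i+1), w (i+2)), and the plane is smooth everywhere else; this
  well-known description is taken as the definition of the singular locus.
\<close>

definition singular_points :: "(3 \<Rightarrow> int) \<Rightarrow> (complex ^ 3) set set" where
  "singular_points w = {vertex w i | i. 1 < w i}"

lemma vertex_in_weighted_plane: "vertex w i \<in> weighted_plane w"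
  unfolding vertex_def weighted_plane_def
  by (rule imageI) (simp add: axis_eq_0_iff)

lemma vertex_eq_iff: "vertex w i = vertex w j \<longleftrightarrow> i = j"
proof
  assume eq: "vertex w i = vertex w j"
  have "axis i 1 \<in> vertex w i"
    unfolding vertex_def weighted_orbit_def
    by (auto simp: vec_eq_iff intro!: exI[of _ 1])
  then obtain t where "(axis i 1 :: complex ^ 3) = (\<chi> l. t powi (w l) * axis j 1 $ l)"
    unfolding eq unfolding vertex_def weighted_orbit_def by auto
  then have "(axis i 1 :: complex ^ 3) $ i = t powi (w i) * axis j 1 $ i"
    by simp
  then show "i = j" by (auto simp: axis_def split: if_splits)
qed simp

lemma vertex_unique:
  assumes "0 < w i" "x \<noteq> 0" "\<And>j. j \<noteq> i \<Longrightarrow> x $ j = 0"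
  shows "weighted_orbit w x = vertex w i"
proof -
  have xi: "x $ i \<noteq> 0"
    using assms(2,3) by (metis vec_eq_iff zero_index)
  define n where "n = nat (w i)"
  have n: "n > 0" "w i = int n" using assms(1) by (auto simp: n_def)
  define c where "c = x $ i powr (1 / of_nat n)"
  have c: "c powi (w i) = x $ i" "c \<noteq> 0"
  proof -
    show "c \<noteq> 0" using xi by (simp add: c_def)
    have "c ^ n = exp (of_nat n * (1 / of_nat n * Ln (x $ i)))"
      using xi by (simp add: c_def powr_def exp_of_nat_mult [symmetric])
    also have "\<dots> = x $ i" using n xi by (simp add: exp_Ln)
    finally show "c powi (w i) = x $ i" by (simp add: n)
  qed
  have x: "x $ j = c powi (w j) * axis i 1 $ j" for j
    using c assms(3)[of j] by (cases "j = i") (auto simp: axis_def)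
  have "\<exists>s. s \<noteq> 0 \<and> (\<chi> l. t powi (w l) * x $ l) = (\<chi> l. s powi (w l) * axis i 1 $ l)"
    if "t \<noteq> 0" for t
    using that c by (intro exI[of _ "t * c"]) (simp add: x vec_eq_iff power_int_mult_distrib)
  moreover have "\<exists>s. s \<noteq> 0 \<and> (\<chi> l. t powi (w l) * axis i 1 $ l) = (\<chi> l. s powi (w l) * x $ l)"
    if "t \<noteq> 0" for t
    using that c
    by (intro exI[of _ "t / c"]) (simp add: x vec_eq_iff power_int_divide_distrib)
  ultimately show ?thesis
    unfolding vertex_def weighted_orbit_def by (smt (verit) Collect_cong)
qed

text \<open>
  Consistency check: the singular points are the orbits with nontrivial isotropy.
\<close>

lemma singular_points_eq_isotropy:
  assumes w: "pos_pairwise_coprime w"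
  shows "singular_points w =
    {weighted_orbit w x | x. x \<noteq> 0 \<and>
       (\<exists>t. t \<noteq> 0 \<and> t \<noteq> 1 \<and> (\<chi> i. t powi (w i) * x $ i) = x)}"
proof (intro equalityI subsetI)
  fix P assume "P \<in> singular_points w"
  then obtain i where i: "P = vertex w i" "1 < w i"
    by (auto simp: singular_points_def)
  define n where "n = nat (w i)"
  have n: "n > 1" "w i = int n" using i by (auto simp: n_def)
  define t where "t = exp (2 * of_real pi * \<i> * of_nat 1 / of_nat n)"
  have tn: "t ^ n = 1" unfolding t_def using n by (intro complex_root_unity) auto
  have t1: "t \<noteq> 1"
    unfolding t_def using n by (subst complex_root_unity_eq_1) auto
  show "P \<in> {weighted_orbit w x | x. x \<noteq> 0 \<and>
       (\<exists>t. t \<noteq> 0 \<and> t \<noteq> 1 \<and> (\<chi> i. t powi (w i) * x $ i) = x)}"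
  proof (intro CollectI exI conjI)
    show "P = weighted_orbit w (axis i 1)" using i by (simp add: vertex_def)
    show "axis i (1::complex) \<noteq> 0" by (simp add: axis_eq_0_iff)
    show "t \<noteq> 0" by (simp add: t_def)
    show "t \<noteq> 1" by (rule t1)
    show "(\<chi> l. t powi (w l) * axis i 1 $ l) = axis i 1"
      using tn n by (auto simp: vec_eq_iff axis_def)
  qed
next
  fix P assume "P \<in> {weighted_orbit w x | x. x \<noteq> 0 \<and>
       (\<exists>t. t \<noteq> 0 \<and> t \<noteq> 1 \<and> (\<chi> i. t powi (w i) * x $ i) = x)}"
  then obtain x t where P: "P = weighted_orbit w x" "x \<noteq> 0"
    and t: "t \<noteq> 0" "t \<noteq> 1" "(\<chi> i. t powi (w i) * x $ i) = x"
    by blast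
  have pw: "t powi (w i) = 1" if "x $ i \<noteq> 0" for i
  proof -
    have "t powi (w i) * x $ i = x $ i" using t(3) by (metis vec_lambda_beta)
    with that show ?thesis by simp
  qed
  obtain i where i: "x $ i \<noteq> 0" using P(2) by (metis vec_eq_iff zero_index)
  have others: "x $ j = 0" if "j \<noteq> i" for j
  proof (rule ccontr)
    assume j: "x $ j \<noteq> 0"
    have "coprime (w i) (w j)" using w that by (auto simp: pos_pairwise_coprime_def)
    then obtain a b where ab: "a * w i + b * w j = 1"
      by (metis bezout_int coprime_iff_gcd_eq_1)
    have "t = t powi (a * w i + b * w j)" using ab by simp
    also have "\<dots> = (t powi w i) powi a * (t powi w j) powi b"
      using t(1) by (simp add: power_int_add mult.commute flip: power_int_mult)
    also have "\<dots> = 1" using pw[OF i] pw[OF j] by simp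
    finally show False using t(2) by simp
  qed
  have wi: "0 < w i" using w by (auto simp: pos_pairwise_coprime_def)
  have "w i \<noteq> 1" using pw[OF i] t(2) by auto
  with wi have "1 < w i" by simp
  moreover have "P = vertex w i"
    unfolding P(1) using wi P(2) others by (rule vertex_unique)
  ultimately show "P \<in> singular_points w"
    by (auto simp: singular_points_def)
qed


subsection \<open>The local invariant\<close>

definition A_count :: "int \<Rightarrow> int \<Rightarrow> int \<Rightarrow> nat" where
  "A_count p q r = card {(i :: int, j :: int). p * i + q * j \<le> q * r \<and> 1 \<le> i \<and> 1 \<le> j}"

definition delta_local :: "int \<Rightarrow> int \<Rightarrow> int \<Rightarrow> real" where
  "delta_local p q r = of_int (r * (q * r - p - q + 1)) / (2 * of_int p)"

text \<open>
  The value of the invariant at the origin of X(p; -1, q).  It does not depend on the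
  choice of r, see \<open>Delta_origin_eq\<close>.
\<close>

definition Delta_origin :: "int \<Rightarrow> int \<Rightarrow> int \<Rightarrow> real" where
  "Delta_origin p q k =
     (let r = (SOME r. 0 \<le> r \<and> [r = modular_inverse p q * k] (mod p))
      in real (A_count p q r) - delta_local p q r)"

text \<open>
  The value at a vertex P, through X(w i; w (i+1), w (i+2)) = X(w i; -1, q), under which
  the index k becomes l.  It does not depend on the choices made, see \<open>Delta_vertex\<close>.
  Only the values at the vertices are meaningful.
\<close>

definition Delta :: "(3 \<Rightarrow> int) \<Rightarrow> (complex ^ 3) set \<Rightarrow> int \<Rightarrow> real" where
  "Delta w P k =
     (let i = (THE i. P = vertex w i);
          q = (SOME q. 0 < q \<and> [q = - modular_inverse (w i) (w (i + 1)) * w (i + 2)] (mod w i));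
          l = (SOME l. 0 \<le> l \<and> [l = - modular_inverse (w i) (w (i + 1)) * k] (mod w i))
      in Delta_origin (w i) q l)"

lemma A_count_eq_sum:
  assumes p: "0 < p" and q: "0 < q"
  shows "int (A_count p q (int n)) = (\<Sum>s<n. (q * int s) div p)"
proof -
  have set: "{(i :: int, j :: int). p * i + q * j \<le> q * int n \<and> 1 \<le> i \<and> 1 \<le> j} =
    (\<lambda>(s, i). (i, int n - int s)) ` (SIGMA s:{..<n}. {1..(q * int s) div p})" (is "?A = ?B")
  proof (intro equalityI subsetI)
    fix u assume "u \<in> ?A"
    then obtain i j where u: "u = (i, j)" "p * i + q * j \<le> q * int n" "1 \<le> i" "1 \<le> j"
      by auto
    have "0 < p * i" using p u by simp
    then have "q * j < q * int n" using u by linarith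
    then have jn: "j < int n" using q by simp
    define s where "s = nat (int n - j)"
    have s: "int s = int n - j" "s < n" using jn u by (auto simp: s_def)
    have "i * p \<le> q * int s" using u by (simp add: s algebra_simps)
    then have "i \<le> (q * int s) div p"
      using p by (metis div_mult_self1_is_m less_imp_neq mult.commute not_sym
          nonzero_mult_div_cancel_right zdiv_mono1)
    then show "u \<in> ?B" using u s by (intro image_eqI[of _ _ "(s, i)"]) auto
  next
    fix u assume "u \<in> ?B"
    then obtain s i where u: "u = (i, int n - int s)" "s < n" "1 \<le> i" "i \<le> (q * int s) div p"
      by auto
    have "p * i \<le> p * ((q * int s) div p)" using u p by simp
    also have "\<dots> \<le> q * int s"
      using p by (metis add.commute le_add_same_cancel2 mult_div_mod_eq pos_mod_sign)
    finally show "u \<in> ?A" using u by (simp add: algebra_simps)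
  qed
  have inj: "inj_on (\<lambda>(s, i). (i :: int, int n - int s)) X" for X
    by (auto simp: inj_on_def)
  have "int (A_count p q (int n)) = int (\<Sum>s<n. card {1..(q * int s) div p})"
    unfolding A_count_def set by (simp add: card_image[OF inj])
  also have "\<dots> = (\<Sum>s<n. (q * int s) div p)"
    using p q by (simp add: pos_imp_zdiv_nonneg_iff)
  finally show ?thesis .
qed

lemma A_minus_delta_eq_sum:
  assumes p: "0 < p" and q: "0 < q"
  shows "real (A_count p q (int n)) - delta_local p q (int n) =
    (\<Sum>s<n. (of_int (p - 1) / 2 - of_int ((q * int s) mod p)) / of_int p)"
proof -
  have "real (A_count p q (int n)) = of_int (\<Sum>s<n. (q * int s) div p)"
    using A_count_eq_sum[OF assms, of n] by (metis of_int_of_nat_eq)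
  moreover have "of_int (\<Sum>s<n. (q * int s) div p) - delta_local p q (int n) =
    (\<Sum>s<n. (of_int (p - 1) / 2 - of_int ((q * int s) mod p)) / of_int p)"
  proof (induction n)
    case (Suc n)
    have "real_of_int (q * int n) = of_int p * of_int ((q * int n) div p) + of_int ((q * int n) mod p)"
      by (metis mult_div_mod_eq of_int_add of_int_mult)
    then have d: "real_of_int ((q * int n) div p) =
        (of_int q * of_nat n - of_int ((q * int n) mod p)) / of_int p"
      using p by (simp add: field_simps)
    have e: "delta_local p q (int (Suc n)) =
        delta_local p q (int n) + (2 * of_int q * of_nat n - of_int p + 1) / (2 * of_int p)"
      unfolding delta_local_def add_divide_distrib [symmetric]
      by (simp add: algebra_simps)
    show ?case
      unfolding sum.lessThan_Suc of_int_add e Suc.IH [symmetric] d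
      using p by (simp add: field_simps)
  qed (simp add: delta_local_def)
  ultimately show ?thesis by simp
qed

lemma sum_residues:
  assumes p: "0 < p" and cop: "coprime p q"
  shows "(\<Sum>s<nat p. (q * int s) mod p) = (\<Sum>s<nat p. int s)"
proof -
  have split: "(\<Sum>s<nat p. f (int s)) = f 0 + (\<Sum>m\<in>{1..<p}. f m)" for f :: "int \<Rightarrow> int"
  proof -
    have "(\<Sum>s<nat p. f (int s)) = (\<Sum>m\<in>{0..<p}. f m)"
      by (rule sum.reindex_bij_witness[of _ nat int]) auto
    also have "{0..<p} = insert 0 {1..<p}" using p by auto
    finally show ?thesis by simp
  qed
  have "(\<Sum>m\<in>{1..<p}. (q * m) mod p) = (\<Sum>m\<in>{1..<p}. m)"
    using sum.reindex_bij_betw[OF bij_betw_int_remainders_mult[of q p], of "\<lambda>m. m"] cop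
    by (simp add: coprime_commute)
  then show ?thesis
    using split[of "\<lambda>m. (q * m) mod p"] split[of "\<lambda>m. m"] by simp
qed

lemma A_minus_delta_periodic:
  assumes p: "0 < p" and q: "0 < q" and cop: "coprime p q"
  shows "(\<Sum>s<n + nat p. (of_int (p - 1) / 2 - of_int ((q * int s) mod p)) / real_of_int p) =
    (\<Sum>s<n. (of_int (p - 1) / 2 - of_int ((q * int s) mod p)) / real_of_int p)"
proof (induction n)
  case 0
  have "2 * (\<Sum>s<m. int s) = int m * (int m - 1)" for m
    by (induction m) (auto simp: algebra_simps)
  from this[of "nat p"] have "2 * (\<Sum>s<nat p. (q * int s) mod p) = p * (p - 1)"
    using p by (simp add: sum_residues[OF p cop])
  then have "2 * real_of_int (\<Sum>s<nat p. (q * int s) mod p) = of_int (p * (p - 1))"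
    by (metis of_int_mult of_int_numeral)
  then show ?case
    using p by (simp add: sum_divide_distrib [symmetric] sum_subtractf)
next
  case (Suc n)
  have "(q * (int n + p)) mod p = (q * int n) mod p"
    by (simp add: distrib_left)
  then show ?case using Suc p by simp
qed

lemma A_minus_delta_cong:
  assumes p: "0 < p" and q: "0 < q" "0 < q'" and cop: "coprime p q"
    and qq: "[q = q'] (mod p)" and r: "0 \<le> r" "0 \<le> r'" and rr: "[r = r'] (mod p)"
  shows "real (A_count p q r) - delta_local p q r = real (A_count p q' r') - delta_local p q' r'"
proof -
  define f where "f n =
    (\<Sum>s<n. (of_int (p - 1) / 2 - of_int ((q * int s) mod p)) / real_of_int p)" for n
  have f1: "real (A_count p q r) - delta_local p q r = f (nat r)" if "0 \<le> r" for r
    using A_minus_delta_eq_sum[OF p q(1), of "nat r"] that by (simp add: f_def)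
  have "(q * int s) mod p = (q' * int s) mod p" for s
    using qq by (metis cong_def mod_mult_left_eq)
  then have f2: "real (A_count p q' r) - delta_local p q' r = f (nat r)" if "0 \<le> r" for r
    using A_minus_delta_eq_sum[OF p q(2), of "nat r"] that by (simp add: f_def)
  have per: "f (n + m * nat p) = f n" for n m
  proof (induction m)
    case (Suc m)
    then show ?case
      using A_minus_delta_periodic[OF p q(1) cop, of "n + m * nat p"]
      by (simp add: f_def algebra_simps)
  qed simp
  have "f n = f (n mod nat p)" for n
    using per[of "n mod nat p" "n div nat p"] by simp
  moreover have "nat r mod nat p = nat r' mod nat p"
    using r rr p by (simp add: cong_def nat_mod_distrib [symmetric])
  ultimately have "f (nat r) = f (nat r')" by metis
  then show ?thesis using f1 f2 r by simp
qed

lemma ex_nonneg_cong: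
  fixes p c :: int
  assumes "0 < p"
  shows "\<exists>r. 0 \<le> r \<and> [r = c] (mod p)"
  using assms by (intro exI[of _ "c mod p"]) auto

lemma ex_pos_cong:
  fixes p c :: int
  assumes "0 < p"
  shows "\<exists>r. 0 < r \<and> [r = c] (mod p)"
  using assms by (intro exI[of _ "c mod p + p"]) (auto simp: cong_def add_nonneg_pos)

lemma Delta_origin_eq:
  assumes "0 < p" "0 < q" "coprime p q" "0 \<le> r" "[r = modular_inverse p q * k] (mod p)"
  shows "Delta_origin p q k = real (A_count p q r) - delta_local p q r"
proof -
  define r' where "r' = (SOME r. 0 \<le> r \<and> [r = modular_inverse p q * k] (mod p))"
  have r': "0 \<le> r'" "[r' = modular_inverse p q * k] (mod p)"
    using someI_ex[OF ex_nonneg_cong[OF assms(1)]] unfolding r'_def by blast+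
  have "[r' = r] (mod p)"
    using r' assms by (meson cong_sym cong_trans)
  then show ?thesis
    unfolding Delta_origin_def r'_def [symmetric] Let_def
    using assms r' by (intro A_minus_delta_cong) auto
qed

lemma Delta_vertex:
  assumes w: "pos_pairwise_coprime w"
    and q: "0 < q" "[q = - modular_inverse (w i) (w (i + 1)) * w (i + 2)] (mod w i)"
    and r: "0 \<le> r" "[r = modular_inverse (w i) (w (i + 2)) * k] (mod w i)"
  shows "Delta w (vertex w i) k = real (A_count (w i) q r) - delta_local (w i) q r"
proof -
  define p a b where "p = w i" and "a = w (i + 1)" and "b = w (i + 2)"
  have p: "0 < p" using w by (auto simp: p_def pos_pairwise_coprime_def)
  have ne: "i \<noteq> i + 1" "i \<noteq> i + 2" by simp_all
  have cop: "coprime a p" "coprime b p"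
    using w ne unfolding pos_pairwise_coprime_def p_def a_def b_def by metis+
  define a' b' where "a' = modular_inverse p a" and "b' = modular_inverse p b"
  have cop': "coprime a' p" using cop by (simp add: a'_def)
  define q' where "q' = (SOME q. 0 < q \<and> [q = - a' * b] (mod p))"
  define l where "l = (SOME l. 0 \<le> l \<and> [l = - a' * k] (mod p))"
  have q': "0 < q'" "[q' = - a' * b] (mod p)"
    using someI_ex[OF ex_pos_cong[OF p]] unfolding q'_def by blast+
  have l: "[l = - a' * k] (mod p)"
    using someI_ex[OF ex_nonneg_cong[OF p]] unfolding l_def by blast
  have D: "Delta w (vertex w i) k = Delta_origin p q' l"
    by (simp add: Delta_def vertex_eq_iff Let_def q'_def l_def p_def a'_def a_def b_def)
  have "coprime (- a' * b) p" using cop cop' by simp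
  then have copq: "coprime q' p" using q'(2) by (metis cong_imp_coprime cong_sym)
  have "[q' * r = (- a' * b) * (b' * k)] (mod p)"
    using r q' by (intro cong_mult) (simp_all add: p_def b'_def b_def)
  also have "(- a' * b) * (b' * k) = (b * b') * (- a' * k)" by (simp add: algebra_simps)
  also have "[\<dots> = 1 * (- a' * k)] (mod p)"
    unfolding b'_def by (intro cong_mult cong_refl cong_modular_inverse1 cop)
  also have "[1 * (- a' * k) = l] (mod p)" using l by (simp add: cong_sym)
  finally have ql: "[q' * r = l] (mod p)" .
  have "[modular_inverse p q' * l = modular_inverse p q' * (q' * r)] (mod p)"
    using ql by (intro cong_mult cong_refl) (rule cong_sym)
  also have "modular_inverse p q' * (q' * r) = (modular_inverse p q' * q') * r" by simp
  also have "[\<dots> = 1 * r] (mod p)"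
    by (intro cong_mult cong_refl cong_modular_inverse2 copq)
  finally have "[r = modular_inverse p q' * l] (mod p)" by (simp add: cong_sym)
  then have "Delta_origin p q' l = real (A_count p q' r) - delta_local p q' r"
    using p q' r copq by (intro Delta_origin_eq) (auto simp: coprime_commute)
  also have "\<dots> = real (A_count p q r) - delta_local p q r"
  proof (rule A_minus_delta_cong)
    show "[q' = q] (mod p)"
      using q q' unfolding p_def a'_def a_def b_def by (meson cong_sym cong_trans)
  qed (use p q q' r copq in \<open>auto simp: coprime_commute\<close>)
  finally show ?thesis by (simp add: D p_def)
qed

end

theory Submission
  imports Defs
begin

text \<open>
  Adding 1 to each coordinate turns the nonnegative solutions of
  \<open>w 0 * x + w 1 * y + w 2 * z = d\<close> into the positive solutions of the same equation
  with right-hand side \<open>k = d + wsum w\<close>, the very argument at which the genus and the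
  local invariants are evaluated. So the claim is that the number of positive solutions equals
  the corrected genus \<open>R k\<close>, that is, the virtual genus minus the local invariants at
  the three vertices (a vertex of weight 1 contributes 0), for every \<open>k > 0\<close>.

  Both sides are compared through their differences. Splitting off the solutions with
  \<open>x = 1\<close> shows that the count grows from \<open>k\<close> to \<open>k + w 0\<close> by the number
  of positive solutions of \<open>w 1 * y + w 2 * z = k\<close>. For two weights that number is known
  in closed form (Popoviciu's formula, \<open>count2_eq_popoviciu\<close>): a linear function of
  \<open>k\<close> minus one sawtooth value for each weight. On the other side the genus grows by
  exactly that linear function. The invariant at the vertex of weight \<open>w 0\<close> does not
  change, because it depends on \<open>k\<close> modulo \<open>w 0\<close>, and the invariants at the other two
  vertices grow by the two sawtooth values (\<open>corrected_genus_step\<close>). The same holds for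
  the shifts by the other weights. Hence the difference of the two sides has two coprime periods
  on the positive integers, so it is constant
  (\<open>constant_on_positive_if_coprime_periods\<close>). It vanishes at \<open>k = w 0\<close>: the count
  is 0 there, and so is \<open>R (w 0)\<close>, because \<open>R 0 = 1\<close> and Popoviciu's expression is
  \<open>- 1\<close> at 0. Popoviciu's formula itself is proved by the same argument, one dimension
  lower.

  The one delicate point is the growth of a local invariant. It is a partial
  sum of sawtooth values whose length is \<open>k / b\<close> modulo the weight of the vertex, where
  \<open>b\<close> is one of the two neighbouring weights, so the shift by \<open>b\<close> adds one summand. The shift by the other weight \<open>a\<close> needs a symmetry between
  the two weights, which is \<open>sawtooth_reciprocity\<close>.
\<close>

section \<open>The sawtooth function\<close>

text \<open>
  This normalisation makes the values over a complete residue system sum to 0, and it is the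
  one in which the summands of \<open>A_minus_delta_eq_sum\<close> appear.
\<close>

definition sawtooth :: "int \<Rightarrow> int \<Rightarrow> real" where
  "sawtooth p x = (of_int (p - 1) / 2 - of_int (x mod p)) / of_int p"

lemma sawtooth_cong: "[x = y] (mod p) \<Longrightarrow> sawtooth p x = sawtooth p y"
  by (simp add: sawtooth_def cong_def)

lemma sawtooth_pred:
  assumes "0 < p"
  shows "sawtooth p (x - 1) = sawtooth p x + 1 / of_int p - of_bool (p dvd x)"
proof -
  have "(x - 1) mod p = (if p dvd x then p - 1 else x mod p - 1)"
  proof (cases "p dvd x")
    case True
    then have "(x - 1) mod p = (- 1) mod p"
      by (metis dvd_imp_mod_0 diff_0 mod_diff_left_eq)
    also have "(- 1) mod p = p - 1" using assms by (simp add: zmod_minus1)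
    finally show ?thesis using True by simp
  next
    case False
    then have "x mod p \<noteq> 0" by auto
    moreover have "0 \<le> x mod p" "x mod p < p" using assms by simp_all
    ultimately have "(x mod p - 1) mod p = x mod p - 1" by (intro mod_pos_pos_trivial) auto
    then show ?thesis using False by (simp add: mod_diff_left_eq)
  qed
  moreover have "x mod p = 0" if "p dvd x" using that by simp
  ultimately show ?thesis
    using assms by (auto simp: sawtooth_def field_simps)
qed

lemma sum_sawtooth_eq_0:
  assumes p: "0 < p" and cop: "coprime p q"
  shows "(\<Sum>n<nat p. sawtooth p (q * int n)) = 0"
proof -
  define q' where "q' = q mod p + p"
  have q': "0 < q'" "[q = q'] (mod p)"
    using p by (auto simp: q'_def cong_def add_nonneg_pos)
  have "coprime p q'" using cop q'(2) by (metis cong_imp_coprime coprime_commute)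
  from A_minus_delta_periodic[OF p q'(1) this, of 0]
  have "(\<Sum>n<nat p. sawtooth p (q' * int n)) = 0"
    by (simp add: sawtooth_def)
  moreover have "sawtooth p (q * int n) = sawtooth p (q' * int n)" for n
    by (intro sawtooth_cong cong_mult q' cong_refl)
  ultimately show ?thesis by simp
qed

lemma cancel_modular_inverse:
  fixes a p c :: int
  assumes "coprime a p"
  shows "[modular_inverse p a * (a * c) = c] (mod p)"
  using cong_mult[OF cong_modular_inverse2[OF assms] cong_refl[of c]] by (simp add: mult.assoc)

text \<open>
  A shift of \<open>m\<close> by \<open>a\<close> lowers the residue of \<open>- m / a\<close> modulo \<open>p\<close> by 1. The increment depends
  on \<open>p\<close> and \<open>m\<close> alone, and this independence of \<open>a\<close> is what makes two different
  weights comparable in \<open>sawtooth_reciprocity\<close>.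
\<close>

lemma sawtooth_step:
  fixes a p m :: int
  assumes p: "0 < p" and cop: "coprime a p"
  shows "sawtooth p (- modular_inverse p a * (m + a)) =
    sawtooth p (- modular_inverse p a * m) + 1 / of_int p - of_bool (p dvd m)"
proof -
  have "[- modular_inverse p a * (m + a) = - modular_inverse p a * m - 1] (mod p)"
    using cong_diff[OF cong_refl[of "- modular_inverse p a * m"] cancel_modular_inverse[OF cop, of 1]]
    by (simp only: mult_minus_left mult_1_right distrib_left minus_add_distrib diff_conv_add_uminus)
  then have "sawtooth p (- modular_inverse p a * (m + a)) = sawtooth p (- modular_inverse p a * m - 1)"
    by (rule sawtooth_cong)
  moreover have "p dvd - modular_inverse p a * m \<longleftrightarrow> p dvd m"
    using cop by (simp add: coprime_dvd_mult_right_iff coprime_commute[of p])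
  ultimately show ?thesis
    using sawtooth_pred[OF p, of "- modular_inverse p a * m"] by simp
qed

text \<open>
  For a function on residues modulo \<open>p\<close>, the growth under one weight determines the
  growth under the other. The defect \<open>e\<close> of the claimed equation is invariant under the
  shift by \<open>b\<close>, since by \<open>sawtooth_step\<close> the two sawtooth values in it change by the
  same amount. As \<open>b\<close> is invertible modulo \<open>p\<close>, \<open>e\<close> is constant. Summing the
  equation over \<open>p\<close> successive shifts by \<open>a\<close> returns \<open>F\<close> to its starting value,
  while the sawtooth values cancel, so the constant is 0.
\<close>

lemma sawtooth_reciprocity:
  fixes F :: "int \<Rightarrow> real" and a b p :: int
  assumes p: "0 < p" and cop: "coprime a p" "coprime b p"
    and per: "\<And>k l. [k = l] (mod p) \<Longrightarrow> F k = F l"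
    and step: "\<And>k. F (k + b) = F k + sawtooth p (- modular_inverse p a * k)"
  shows "F (k + a) = F k + sawtooth p (- modular_inverse p b * k)"
proof -
  define e where "e k = F (k + a) - F k - sawtooth p (- modular_inverse p b * k)" for k
  have e_b: "e (k + b) = e k" for k
  proof -
    have "F (k + b + a) = F (k + a) + sawtooth p (- modular_inverse p a * (k + a))"
      using step[of "k + a"] by (simp add: add.commute add.left_commute)
    then show ?thesis
      unfolding e_def sawtooth_step[OF p cop(2)] sawtooth_step[OF p cop(1)] step[of k] by simp
  qed
  have e_mult: "e (b * int n) = e 0" for n
  proof (induction n)
    case (Suc n)
    then show ?case using e_b[of "b * int n"] by (simp add: algebra_simps)
  qed simp
  have e_per: "e k = e l" if "[k = l] (mod p)" for k l
  proof -
    have "F (k + a) = F (l + a)" "F k = F l" using that by (auto intro!: per cong_add)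
    moreover have "sawtooth p (- modular_inverse p b * k) = sawtooth p (- modular_inverse p b * l)"
      using that by (intro sawtooth_cong cong_mult cong_refl)
    ultimately show ?thesis by (simp add: e_def)
  qed
  have e_const: "e k = e 0" for k
  proof -
    define n where "n = nat ((modular_inverse p b * k) mod p)"
    have "[b * int n = b * (modular_inverse p b * k)] (mod p)"
      using p by (intro cong_mult cong_refl) (simp add: n_def)
    also have "b * (modular_inverse p b * k) = modular_inverse p b * (b * k)" by simp
    also have "[\<dots> = k] (mod p)" by (rule cancel_modular_inverse[OF cop(2)])
    finally show ?thesis using e_per e_mult by metis
  qed
  have tel: "F (a * int n) = F 0 + (\<Sum>s<n. sawtooth p (- modular_inverse p b * a * int s)) + n * e 0" for n
  proof (induction n)
    case (Suc n)
    have "F (a * int n + a) = F (a * int n) + sawtooth p (- modular_inverse p b * (a * int n)) + e 0"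
      using e_const[of "a * int n"] by (simp add: e_def)
    with Suc show ?case by (simp add: algebra_simps)
  qed simp
  have "coprime p (- modular_inverse p b * a)"
    using cop by (simp add: coprime_commute[of p])
  from sum_sawtooth_eq_0[OF p this] tel[of "nat p"]
  have "F (a * p) = F 0 + of_int p * e 0" using p by simp
  moreover have "F (a * p) = F 0" by (rule per) (simp add: cong_def)
  ultimately have "e 0 = 0" using p by simp
  then show ?thesis using e_const[of k] by (simp add: e_def)
qed

section \<open>Functions with two coprime periods\<close>

text \<open>
  Periodicity holds only on the positive integers, so the walk from \<open>k\<close> to \<open>l\<close> must
  not leave them: it goes up by a multiple \<open>a x\<close> with \<open>x \<ge> 0\<close> before the remaining
  distance, a multiple of \<open>b\<close>, is covered.
\<close>

lemma constant_on_positive_if_coprime_periods: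
  fixes f :: "int \<Rightarrow> 'a"
  assumes ab: "0 < a" "0 < b" "coprime a b"
    and fa: "\<And>k. 0 < k \<Longrightarrow> f (k + a) = f k"
    and fb: "\<And>k. 0 < k \<Longrightarrow> f (k + b) = f k"
    and kl: "0 < k" "0 < l"
  shows "f k = f l"
proof -
  have mult: "f (k + c * int n) = f k"
    if "0 < k" "0 < c" and step: "\<And>k. 0 < k \<Longrightarrow> f (k + c) = f k" for c k n
  proof (induction n)
    case (Suc n)
    have "0 < k + c * int n" using that by (simp add: add_pos_nonneg)
    from step[OF this] Suc show ?case by (simp add: algebra_simps)
  qed simp
  obtain u v where uv: "u * a + v * b = 1"
    using ab(3) by (metis bezout_int coprime_iff_gcd_eq_1)
  \<comment> \<open>As \<open>u\<close> inverts \<open>a\<close> modulo \<open>b\<close>, this is the least \<open>x \<ge> 0\<close>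
      with \<open>k + a x\<close> congruent to \<open>l\<close> modulo \<open>b\<close>.\<close>
  define x where "x = (u * (l - k)) mod b"
  have x: "0 \<le> x" using ab by (simp add: x_def)
  have "[a * x = a * (u * (l - k))] (mod b)"
    unfolding x_def by (intro cong_mult cong_refl) simp
  also have "a * (u * (l - k)) = (l - k) - b * (v * (l - k))"
    using arg_cong[OF uv, of "\<lambda>t. t * (l - k)"] by (simp add: algebra_simps)
  also have "[\<dots> = l - k] (mod b)" by (simp add: cong_iff_dvd_diff)
  finally obtain y where y: "k + a * x = l + b * y"
    by (metis add_diff_eq cong_iff_lin cong_sym diff_add_cancel add.commute)
  show ?thesis
  proof (cases "0 \<le> y")
    case True
    have "f k = f (k + a * int (nat x))" using mult[of k a "nat x"] kl ab fa by metis
    also have "\<dots> = f (l + b * int (nat y))" using x True y by simp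
    also have "\<dots> = f l" using mult[of l b "nat y"] kl ab fb by metis
    finally show ?thesis .
  next
    case False
    have "f k = f (k + a * int (nat x))" using mult[of k a "nat x"] kl ab fa by metis
    also have "\<dots> = f (k + a * int (nat x) + b * int (nat (- y)))"
      using mult[of "k + a * int (nat x)" b "nat (- y)"] kl ab fb by (simp add: add_pos_nonneg)
    also have "k + a * int (nat x) + b * int (nat (- y)) = l" using x False y by simp
    finally show ?thesis .
  qed
qed

section \<open>Two weights: Popoviciu's formula\<close>

definition count2 :: "int \<Rightarrow> int \<Rightarrow> int \<Rightarrow> nat" where
  "count2 a b m = card {(y :: int, z :: int). 1 \<le> y \<and> 1 \<le> z \<and> a * y + b * z = m}"

text \<open>
  Popoviciu's formula is usually written with fractional parts, for nonnegative solutions. For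
  positive solutions it takes this symmetric form in terms of the sawtooth function.
\<close>

definition popoviciu :: "int \<Rightarrow> int \<Rightarrow> int \<Rightarrow> real" where
  "popoviciu a b m = of_int (2 * m - a - b) / (2 * of_int (a * b))
     - sawtooth a (- modular_inverse a b * m) - sawtooth b (- modular_inverse b a * m)"

lemma le_if_pos_combination:
  fixes a x c m :: int
  assumes "0 < a" "1 \<le> x" "0 \<le> c" "a * x + c = m"
  shows "x \<le> m"
proof -
  have "1 * x \<le> a * x" using assms by (intro mult_right_mono) auto
  then show ?thesis using assms by linarith
qed

lemma finite_count2:
  assumes "0 < a" "0 < b"
  shows "finite {(y :: int, z :: int). 1 \<le> y \<and> 1 \<le> z \<and> a * y + b * z = m}"
proof (rule finite_subset)
  show "{(y :: int, z :: int). 1 \<le> y \<and> 1 \<le> z \<and> a * y + b * z = m} \<subseteq> {1..m} \<times> {1..m}"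
  proof clarify
    fix y z :: int
    assume yz: "1 \<le> y" "1 \<le> z" and m: "m = a * y + b * z"
    have "0 \<le> a * y" "0 \<le> b * z" using yz assms by simp_all
    then show "y \<in> {1..a * y + b * z} \<and> z \<in> {1..a * y + b * z}"
      using yz assms le_if_pos_combination[of a y "b * z"] le_if_pos_combination[of b z "a * y"]
      by (simp add: add.commute)
  qed
qed simp

lemma count2_commute: "count2 a b m = count2 b a m"
  unfolding count2_def
  by (rule bij_betw_same_card[of prod.swap], rule bij_betw_byWitness[of _ prod.swap]) auto

text \<open>
  The solutions with \<open>y = 1\<close> are those of \<open>b z = m\<close>; lowering \<open>y\<close> by 1 in the others
  gives the solutions for \<open>m\<close>. At \<open>m = 0\<close> the recursion fails, because \<open>z = 0\<close> is
  not positive.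
\<close>

lemma count2_step:
  assumes ab: "0 < a" "0 < b" and m: "0 < m"
  shows "count2 a b (m + a) = count2 a b m + of_bool (b dvd m)"
proof -
  let ?S = "\<lambda>m. {(y :: int, z :: int). 1 \<le> y \<and> 1 \<le> z \<and> a * y + b * z = m}"
  let ?T = "{(y :: int, z :: int). y = 1 \<and> 1 \<le> z \<and> b * z = m}"
  let ?s = "\<lambda>(y :: int, z :: int). (y + 1, z)"
  have "?S (m + a) = ?s ` ?S m \<union> ?T"
  proof (intro equalityI subsetI)
    fix u assume "u \<in> ?S (m + a)"
    then obtain y z where u: "u = (y, z)" "1 \<le> y" "1 \<le> z" "a * y + b * z = m + a" by auto
    show "u \<in> ?s ` ?S m \<union> ?T"
    proof (cases "y = 1")
      case False
      have "u = ?s (y - 1, z)" "(y - 1, z) \<in> ?S m" using u False by (auto simp: algebra_simps)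
      then show ?thesis by blast
    qed (use u in auto)
  qed (auto simp: algebra_simps)
  moreover have "?s ` ?S m \<inter> ?T = {}" by auto
  moreover have "card (?s ` ?S m) = count2 a b m"
    unfolding count2_def by (rule card_image) (auto simp: inj_on_def)
  moreover have T: "?T = (if b dvd m then {(1, m div b)} else {})"
  proof -
    have "z = m div b \<and> b dvd m" if "b * z = m" for z using that ab by auto
    moreover have "1 \<le> m div b" if "b dvd m" using that ab m by (auto simp: dvd_def zero_less_mult_iff)
    ultimately show ?thesis using ab by auto
  qed
  moreover have "finite ?T" unfolding T by simp
  moreover have "finite (?s ` ?S m)" using finite_count2[OF ab] by (rule finite_imageI)
  ultimately have "card (?S (m + a)) = count2 a b m + card ?T" by (simp add: card_Un_disjoint)
  then show ?thesis unfolding T count2_def[of a b "m + a"] by simp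
qed

lemma popoviciu_commute: "popoviciu a b m = popoviciu b a m"
  by (simp add: popoviciu_def algebra_simps)

lemma popoviciu_step:
  assumes ab: "0 < a" "0 < b" "coprime a b"
  shows "popoviciu a b (m + a) = popoviciu a b m + of_bool (b dvd m)"
proof -
  have "[- modular_inverse a b * (m + a) = - modular_inverse a b * m] (mod a)"
    by (simp add: cong_iff_dvd_diff algebra_simps)
  then have "sawtooth a (- modular_inverse a b * (m + a)) = sawtooth a (- modular_inverse a b * m)"
    by (rule sawtooth_cong)
  then show ?thesis
    unfolding popoviciu_def sawtooth_step[OF ab(2,3)]
    using ab by (simp add: field_simps)
qed

text \<open>
  The number of solutions for 0 is 0, not \<open>- 1\<close>. The value \<open>- 1\<close> is used to start
  \<open>popoviciu_step\<close>, which turns it into the correct number 0 at \<open>m = a\<close>.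
\<close>

lemma popoviciu_0:
  assumes "0 < a" "0 < b"
  shows "popoviciu a b 0 = - 1"
  using assms by (simp add: popoviciu_def sawtooth_def field_simps)

text \<open>
  The two sides grow equally under the shifts by \<open>a\<close> and by \<open>b\<close>, so their difference is
  constant; at \<open>m = a\<close> both are 0.
\<close>

lemma count2_eq_popoviciu:
  assumes ab: "0 < a" "0 < b" "coprime a b" and m: "0 < m"
  shows "real (count2 a b m) = popoviciu a b m"
proof -
  define f where "f m = real (count2 a b m) - popoviciu a b m" for m
  have "f m = f a"
  proof (rule constant_on_positive_if_coprime_periods[where f = f, OF ab _ _ m ab(1)])
    fix k :: int assume k: "0 < k"
    show "f (k + a) = f k"
      using count2_step[OF ab(1,2) k] popoviciu_step[OF ab] by (simp add: f_def)
    have "coprime b a" using ab(3) by (simp add: coprime_commute)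
    then show "f (k + b) = f k"
      using count2_step[OF ab(2,1) k] popoviciu_step[OF ab(2,1)]
      by (simp add: f_def count2_commute[of a b] popoviciu_commute[of a b])
  qed
  moreover have "count2 a b a = 0"
  proof -
    have "a * y + b * z \<noteq> a" if "1 \<le> y" "1 \<le> z" for y z
    proof -
      have "a * 1 \<le> a * y" using that ab by (intro mult_left_mono) auto
      moreover have "0 < b * z" using that ab by simp
      ultimately show ?thesis by linarith
    qed
    then have "{(y :: int, z :: int). 1 \<le> y \<and> 1 \<le> z \<and> a * y + b * z = a} = {}" by blast
    then show ?thesis unfolding count2_def by (metis card.empty)
  qed
  moreover have "popoviciu a b a = 0"
    using popoviciu_step[OF ab, of 0] popoviciu_0[OF ab(1,2)] by simp
  ultimately show ?thesis by (simp add: f_def)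
qed

section \<open>Three weights: the counting side\<close>

definition count3 :: "int \<Rightarrow> int \<Rightarrow> int \<Rightarrow> int \<Rightarrow> nat" where
  "count3 a b c k = card {(x :: int, y :: int, z :: int).
     1 \<le> x \<and> 1 \<le> y \<and> 1 \<le> z \<and> a * x + b * y + c * z = k}"

lemma finite_count3:
  assumes "0 < a" "0 < b" "0 < c"
  shows "finite {(x :: int, y :: int, z :: int).
    1 \<le> x \<and> 1 \<le> y \<and> 1 \<le> z \<and> a * x + b * y + c * z = k}" (is "finite ?S")
proof (rule finite_subset)
  show "?S \<subseteq> {1..k} \<times> {1..k} \<times> {1..k}"
  proof
    fix u assume "u \<in> ?S"
    then obtain x y z where u: "u = (x, y, z)" "1 \<le> x" "1 \<le> y" "1 \<le> z"
      "a * x + b * y + c * z = k" by auto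
    have "0 \<le> a * x" "0 \<le> b * y" "0 \<le> c * z" using u assms by simp_all
    then show "u \<in> {1..k} \<times> {1..k} \<times> {1..k}"
      using u assms le_if_pos_combination[of a x "b * y + c * z" k]
        le_if_pos_combination[of b y "a * x + c * z" k]
        le_if_pos_combination[of c z "a * x + b * y" k] by auto
  qed
qed simp

lemma count3_rotate: "count3 a b c k = count3 b c a k"
  unfolding count3_def
  by (rule bij_betw_same_card[of "\<lambda>(x, y, z). (y, z, x)"],
      rule bij_betw_byWitness[of _ "\<lambda>(y, z, x). (x, y, z)"]) auto

lemma count3_step:
  assumes abc: "0 < a" "0 < b" "0 < c"
  shows "count3 a b c (k + a) = count3 a b c k + count2 b c k"
proof -
  let ?S = "\<lambda>k. {(x :: int, y :: int, z :: int).
    1 \<le> x \<and> 1 \<le> y \<and> 1 \<le> z \<and> a * x + b * y + c * z = k}"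
  let ?T = "{(y :: int, z :: int). 1 \<le> y \<and> 1 \<le> z \<and> b * y + c * z = k}"
  let ?s = "\<lambda>(x :: int, y :: int, z :: int). (x + 1, y, z)"
  have "?S (k + a) = ?s ` ?S k \<union> Pair 1 ` ?T"
  proof (intro equalityI subsetI)
    fix u assume "u \<in> ?S (k + a)"
    then obtain x y z where u: "u = (x, y, z)" "1 \<le> x" "1 \<le> y" "1 \<le> z"
      "a * x + b * y + c * z = k + a" by auto
    show "u \<in> ?s ` ?S k \<union> Pair 1 ` ?T"
    proof (cases "x = 1")
      case False
      have "u = ?s (x - 1, y, z)" "(x - 1, y, z) \<in> ?S k" using u False by (auto simp: algebra_simps)
      then show ?thesis by blast
    qed (use u in auto)
  qed (auto simp: algebra_simps)
  moreover have "?s ` ?S k \<inter> Pair 1 ` ?T = {}" by auto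
  moreover have "card (?s ` ?S k) = count3 a b c k"
    unfolding count3_def by (rule card_image) (auto simp: inj_on_def)
  moreover have "card (Pair (1 :: int) ` ?T) = count2 b c k"
    unfolding count2_def by (rule card_image) (auto simp: inj_on_def)
  moreover have "finite (Pair (1 :: int) ` ?T)" "finite (?s ` ?S k)"
    using finite_count2 finite_count3 abc by blast+
  ultimately have "card (?S (k + a)) = count3 a b c k + count2 b c k"
    by (simp add: card_Un_disjoint)
  then show ?thesis by (simp add: count3_def)
qed

lemma count3_first_weight:
  assumes abc: "0 < a" "0 < b" "0 < c"
  shows "count3 a b c a = 0"
proof -
  have "a * x + b * y + c * z \<noteq> a" if "1 \<le> x" "1 \<le> y" "1 \<le> z" for x y z
  proof -
    have "a * 1 \<le> a * x" using that abc by (intro mult_left_mono) auto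
    moreover have "0 < b * y" "0 < c * z" using that abc by simp_all
    ultimately show ?thesis by linarith
  qed
  then have "{(x :: int, y :: int, z :: int).
     1 \<le> x \<and> 1 \<le> y \<and> 1 \<le> z \<and> a * x + b * y + c * z = a} = {}" by blast
  then show ?thesis unfolding count3_def by (metis card.empty)
qed

lemma ehrhart_eq_count3: "ehrhart w d = count3 (w 0) (w 1) (w 2) (d + wsum w)"
  unfolding ehrhart_def count3_def wsum_def
  by (rule bij_betw_same_card[of "\<lambda>(x, y, z). (x + 1, y + 1, z + 1)"],
      rule bij_betw_byWitness[of _ "\<lambda>(x, y, z). (x - 1, y - 1, z - 1)"])
     (auto simp: algebra_simps)

section \<open>Growth of the local invariants\<close>

lemma pos_pairwise_coprimeD:
  assumes "pos_pairwise_coprime w"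
  shows "0 < w i" "coprime (w (i + 1)) (w i)" "coprime (w (i + 2)) (w i)"
proof -
  have "i + 1 \<noteq> i" "i + 2 \<noteq> i" by simp_all
  then show "0 < w i" "coprime (w (i + 1)) (w i)" "coprime (w (i + 2)) (w i)"
    using assms unfolding pos_pairwise_coprime_def by metis+
qed

text \<open>
  The invariant becomes a partial sum of sawtooth values. Its length \<open>n\<close> may be any
  representative of the residue class, so that \<open>n\<close> can be taken to \<open>n + 1\<close> below without
  reduction modulo \<open>w i\<close>.
\<close>

lemma Delta_vertex_eq_sum:
  assumes w: "pos_pairwise_coprime w"
    and q: "0 < q" "[q = - modular_inverse (w i) (w (i + 1)) * w (i + 2)] (mod w i)"
    and n: "[int n = modular_inverse (w i) (w (i + 2)) * k] (mod w i)"
  shows "Delta w (vertex w i) k = (\<Sum>s<n. sawtooth (w i) (q * int s))"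
  using Delta_vertex[OF w q _ n] A_minus_delta_eq_sum[OF pos_pairwise_coprimeD(1)[OF w] q(1)]
  by (simp add: sawtooth_def)

lemma ex_nat_cong:
  fixes p c :: int
  assumes "0 < p"
  shows "\<exists>n. [int n = c] (mod p)"
  using assms by (intro exI[of _ "nat (c mod p)"]) simp

lemma Delta_vertex_cong:
  assumes w: "pos_pairwise_coprime w" and kl: "[k = l] (mod w i)"
  shows "Delta w (vertex w i) k = Delta w (vertex w i) l"
proof -
  have p: "0 < w i" using pos_pairwise_coprimeD(1)[OF w] .
  obtain q where q: "0 < q" "[q = - modular_inverse (w i) (w (i + 1)) * w (i + 2)] (mod w i)"
    using ex_pos_cong[OF p] by blast
  obtain n where n: "[int n = modular_inverse (w i) (w (i + 2)) * k] (mod w i)"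
    using ex_nat_cong[OF p] by blast
  have "[int n = modular_inverse (w i) (w (i + 2)) * l] (mod w i)"
    using n kl by (meson cong_trans cong_mult cong_refl)
  then show ?thesis using Delta_vertex_eq_sum[OF w q] n by metis
qed

lemma Delta_vertex_0:
  assumes w: "pos_pairwise_coprime w"
  shows "Delta w (vertex w i) 0 = 0"
proof -
  obtain q where q: "0 < q" "[q = - modular_inverse (w i) (w (i + 1)) * w (i + 2)] (mod w i)"
    using ex_pos_cong[OF pos_pairwise_coprimeD(1)[OF w]] by blast
  show ?thesis using Delta_vertex_eq_sum[OF w q, of 0 0] by simp
qed

lemma Delta_vertex_smooth:
  assumes w: "pos_pairwise_coprime w" and "w i = 1"
  shows "Delta w (vertex w i) k = 0"
  using Delta_vertex_cong[OF w, of k 0 i] Delta_vertex_0[OF w] assms(2) by simp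

text \<open>
  Raising \<open>k\<close> by \<open>w (i + 2)\<close> raises the length of the partial sum by one.
\<close>

lemma Delta_vertex_step_second:
  assumes w: "pos_pairwise_coprime w"
  shows "Delta w (vertex w i) (k + w (i + 2)) =
    Delta w (vertex w i) k + sawtooth (w i) (- modular_inverse (w i) (w (i + 1)) * k)"
proof -
  define p a b where "p = w i" and "a = w (i + 1)" and "b = w (i + 2)"
  have p: "0 < p" and cop: "coprime b p"
    using pos_pairwise_coprimeD[OF w] by (auto simp: p_def b_def)
  obtain q where q: "0 < q" "[q = - modular_inverse p a * b] (mod p)"
    using ex_pos_cong[OF p] by blast
  obtain n where n: "[int n = modular_inverse p b * k] (mod p)"
    using ex_nat_cong[OF p] by blast
  have "[int n + 1 = modular_inverse p b * k + modular_inverse p b * (b * 1)] (mod p)"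
    by (intro cong_add n cong_sym[OF cancel_modular_inverse[OF cop]])
  then have Sn: "[int (Suc n) = modular_inverse p b * (k + b)] (mod p)"
    by (simp add: algebra_simps)
  have "[q * int n = (- modular_inverse p a * b) * (modular_inverse p b * k)] (mod p)"
    by (intro cong_mult q n)
  also have "(- modular_inverse p a * b) * (modular_inverse p b * k) =
      - modular_inverse p a * (modular_inverse p b * (b * k))" by simp
  also have "[\<dots> = - modular_inverse p a * k] (mod p)"
    by (intro cong_mult cong_refl cancel_modular_inverse cop)
  finally have "sawtooth p (q * int n) = sawtooth p (- modular_inverse p a * k)"
    by (rule sawtooth_cong)
  then show ?thesis
    using Delta_vertex_eq_sum[OF w q[unfolded p_def a_def b_def] n[unfolded p_def b_def]]
      Delta_vertex_eq_sum[OF w q[unfolded p_def a_def b_def] Sn[unfolded p_def b_def]]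
    by (simp add: p_def a_def b_def)
qed

text \<open>
  In the partial sum the weight \<open>w (i + 1)\<close> only appears inverted, in the factor
  \<open>q\<close>, and a shift by it changes the length in no simple way; so the growth in this direction is obtained by reciprocity.
\<close>

lemma Delta_vertex_step_first:
  assumes w: "pos_pairwise_coprime w"
  shows "Delta w (vertex w i) (k + w (i + 1)) =
    Delta w (vertex w i) k + sawtooth (w i) (- modular_inverse (w i) (w (i + 2)) * k)"
  by (rule sawtooth_reciprocity[where F = "Delta w (vertex w i)" and b = "w (i + 2)"])
    (fact pos_pairwise_coprimeD[OF w] Delta_vertex_cong[OF w] Delta_vertex_step_second[OF w])+

section \<open>The corrected genus\<close>

text \<open>
  The sum runs over all vertices, not only the singular ones, so that no case
  distinction on weights equal to 1 is needed; \<open>sum_singular_points\<close> shows that the total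
  is the same.
\<close>

definition corrected_genus :: "(3 \<Rightarrow> int) \<Rightarrow> int \<Rightarrow> real" where
  "corrected_genus w k = virtual_genus w k - (\<Sum>i\<in>UNIV. Delta w (vertex w i) k)"

lemma sum_singular_points:
  assumes w: "pos_pairwise_coprime w"
  shows "(\<Sum>P\<in>singular_points w. Delta w P k) = (\<Sum>i\<in>UNIV. Delta w (vertex w i) k)"
proof -
  have "singular_points w = vertex w ` {i. 1 < w i}"
    by (auto simp: singular_points_def)
  moreover have "inj (vertex w)" by (simp add: inj_def vertex_eq_iff)
  ultimately have "(\<Sum>P\<in>singular_points w. Delta w P k) = (\<Sum>i | 1 < w i. Delta w (vertex w i) k)"
    by (simp add: sum.reindex inj_on_subset)
  also have "\<dots> = (\<Sum>i\<in>UNIV. Delta w (vertex w i) k)"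
  proof (rule sum.mono_neutral_left)
    show "\<forall>i\<in>UNIV - {i. 1 < w i}. Delta w (vertex w i) k = 0"
      using pos_pairwise_coprimeD(1)[OF w] Delta_vertex_smooth[OF w]
      by (metis Compl_iff Compl_eq_Diff_UNIV int_one_le_iff_zero_less linorder_neqE_linordered_idom
          mem_Collect_eq not_less)
  qed auto
  finally show ?thesis .
qed

lemma numerals_mod_3: "(3 :: 3) = 0" "(4 :: 3) = 1"
  by simp_all

lemma cases_mod_3:
  fixes j :: 3
  obtains "j = 0" | "j = 1" | "j = 2"
  using exhaust_3[of j] by auto

lemma sum_cyclic: "(\<Sum>i\<in>UNIV. f i) = f j + f (j + 1) + f (j + 2)" for j :: 3
  by (cases j rule: cases_mod_3) (simp_all add: sum_3 numerals_mod_3 ac_simps)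

lemma wsum_cyclic: "wsum w = w j + w (j + 1) + w (j + 2)"
  by (cases j rule: cases_mod_3) (simp_all add: wsum_def numerals_mod_3)

lemma wprod_cyclic: "wprod w = w j * w (j + 1) * w (j + 2)"
  by (cases j rule: cases_mod_3) (simp_all add: wprod_def numerals_mod_3)

text \<open>
  Relative to the vertex \<open>j + 1\<close> the weight \<open>w j\<close> is the second neighbour, and relative
  to \<open>j + 2\<close> it is the first, so the two growth lemmas supply the two sawtooth terms of
  Popoviciu's formula; the genus supplies the linear term.
\<close>

lemma corrected_genus_step:
  assumes w: "pos_pairwise_coprime w"
  shows "corrected_genus w (k + w j) = corrected_genus w k + popoviciu (w (j + 1)) (w (j + 2)) k"
proof -
  have pos: "0 < w i" for i using pos_pairwise_coprimeD(1)[OF w] .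
  have genus: "virtual_genus w (k + w j) = virtual_genus w k +
      of_int (2 * k - w (j + 1) - w (j + 2)) / (2 * of_int (w (j + 1) * w (j + 2)))"
  proof -
    have "of_int (2 * k - w (j + 1) - w (j + 2)) / (2 * real_of_int (w (j + 1) * w (j + 2))) =
        of_int (w j) * of_int (2 * k - w (j + 1) - w (j + 2)) / (2 * of_int (wprod w))"
      using pos[of j] by (simp add: wprod_cyclic[of w j])
    then show ?thesis
      unfolding virtual_genus_def
      by (simp add: add_divide_distrib [symmetric] diff_divide_distrib [symmetric])
        (simp add: wsum_cyclic[of w j] algebra_simps)
  qed
  have at_j: "Delta w (vertex w j) (k + w j) = Delta w (vertex w j) k"
    by (rule Delta_vertex_cong[OF w]) (simp add: cong_def)
  have idx: "j + 1 + 2 = j" "j + 1 + 1 = j + 2" "j + 2 + 1 = j" "j + 2 + 2 = j + 1"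
    by (cases j rule: cases_mod_3; simp add: numerals_mod_3)+
  show ?thesis
    using Delta_vertex_step_second[OF w, of "j + 1" k, unfolded idx]
      Delta_vertex_step_first[OF w, of "j + 2" k, unfolded idx]
    unfolding corrected_genus_def sum_cyclic[of _ j] genus at_j popoviciu_def by linarith
qed

lemma corrected_genus_0:
  assumes w: "pos_pairwise_coprime w"
  shows "corrected_genus w 0 = 1"
  by (simp add: corrected_genus_def virtual_genus_def Delta_vertex_0[OF w])

text \<open>
  The difference of the two sides has the coprime periods \<open>w 0\<close> and \<open>w 1\<close>, and it is
  0 at \<open>w 0\<close>. The value of the corrected genus there is reached from its value 1 at 0, where the local invariants are empty sums.
\<close>

lemma count3_eq_corrected_genus:
  assumes w: "pos_pairwise_coprime w" and k: "0 < k"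
  shows "real (count3 (w 0) (w 1) (w 2) k) = corrected_genus w k"
proof -
  define f where "f k = real (count3 (w 0) (w 1) (w 2) k) - corrected_genus w k" for k
  have pos: "0 < w i" for i using pos_pairwise_coprimeD(1)[OF w] .
  have "coprime (w i) (w j)" if "i \<noteq> j" for i j
    using w that unfolding pos_pairwise_coprime_def by blast
  from this[of 0 1] this[of 1 2] this[of 2 0]
  have cop: "coprime (w 0) (w 1)" "coprime (w 1) (w 2)" "coprime (w 2) (w 0)"
    by simp_all
  have "f k = f (w 0)"
  proof (rule constant_on_positive_if_coprime_periods[where f = f and a = "w 0" and b = "w 1",
        OF pos pos cop(1) _ _ k pos])
    fix k :: int assume k: "0 < k"
    show "f (k + w 0) = f k"
      using corrected_genus_step[OF w, of k 0] count3_step[OF pos pos pos, of 0 1 2 k]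
        count2_eq_popoviciu[OF pos pos cop(2) k] by (simp add: f_def)
    show "f (k + w 1) = f k"
      using corrected_genus_step[OF w, of k 1] count3_step[OF pos pos pos, of 1 2 0 k]
        count2_eq_popoviciu[OF pos pos cop(3) k]
      by (simp add: f_def count3_rotate[of "w 0"] numerals_mod_3)
  qed
  moreover have "corrected_genus w (w 0) = 0"
    using corrected_genus_step[OF w, of 0 0] corrected_genus_0[OF w] popoviciu_0[OF pos pos]
    by simp
  ultimately show ?thesis
    using count3_first_weight[OF pos pos pos, of 0 1 2] by (simp add: f_def)
qed

theorem theorem1p1:
  fixes w :: "3 \<Rightarrow> int" and d :: int
  assumes "pos_pairwise_coprime w" and "0 \<le> d"
  shows "real (ehrhart w d) =
    virtual_genus w (d + wsum w) - (\<Sum>P\<in>singular_points w. Delta w P (d + wsum w))"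
proof -
  have "0 < wsum w"
    using pos_pairwise_coprimeD(1)[OF assms(1)] by (simp add: wsum_def add_pos_pos)
  then have "0 < d + wsum w" using assms(2) by simp
  from count3_eq_corrected_genus[OF assms(1) this] show ?thesis
    by (simp add: ehrhart_eq_count3 corrected_genus_def sum_singular_points[OF assms(1)])
qed

end
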